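(* For every graph $G$, $b(G) \le b_g(G) \le 2b(G)-1$ and $b(G) \le \widehat{b_g}(G) \le 2b(G)$.
   Context: All graphs are finite, simple and undirected. A configuration of a graph $G$ is a map $f: V(G) \to \mathbb{N}\cup\{0\}$, where $f(v)$ is the number of brushes on $v$. Starting from a configuration with all vertices dirty, a dirty vertex $v$ may fire (be cleaned) when it has at least as many brushes as dirty neighbors; when it fires, one brush is added to each dirty neighbor of $v$, and $v$ is marked clean. $G$ can be cleaned by $f$ if some sequence of vertex firings, starting from $f$, results in every vertex being clean. The brush number $b(G)$ is the minimum of $\sum_{v} f(v)$ over all configurations $f$ by which $G$ can be cleaned. The brushing game on $G$ is played by two players, Max and Min. Initially all vertices are dirty and no vertex contains any brushes. The players alternate turns. On each turn, the player whose turn it is adds one brush to any dirty vertex; then vertices that are able to fire do so, sequentially (in an arbitrary order; the order does not affect the outcome), until no more vertices may fire, at which point the turn ends. If at this point all vertices of $G$ are clean, the game ends. The length of the game is the number of brushes placed by the players (the number of turns). Min aims to minimize it, Max aims to maximize it. When both players play optimally, the length of the game is denoted $b_g(G)$ if Min takes the first turn, and $\widehat{b_g}(G)$ if Max takes the first turn.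
   Formalization: The two upper bounds are stated only for graphs with at least one edge, since they fail for nonempty edgeless graphs (a single vertex has b = 0 while both game lengths are 1); the lower bounds hold for every graph. *)

theory Defs
  imports Main
begin

definition simple_graph :: "'a set \<Rightarrow> 'a set set \<Rightarrow> bool" where
  "simple_graph V E \<longleftrightarrow> finite V \<and> (\<forall>e\<in>E. e \<subseteq> V \<and> card e = 2)"

text \<open>A state consists of the number of brushes on each vertex and the set of dirty vertices.\<close>

type_synonym 'a state = "('a \<Rightarrow> nat) \<times> 'a set"

definition dirty_nbrs :: "'a set set \<Rightarrow> 'a set \<Rightarrow> 'a \<Rightarrow> 'a set" where
  "dirty_nbrs E D v = {u \<in> D. {u, v} \<in> E}"

inductive fire :: "'a set set \<Rightarrow> 'a state \<Rightarrow> 'a state \<Rightarrow> bool" for E where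
  "v \<in> D \<Longrightarrow> card (dirty_nbrs E D v) \<le> f v \<Longrightarrow>
   fire E (f, D) (\<lambda>u. if u \<in> dirty_nbrs E D v then f u + 1 else f u, D - {v})"

definition stable :: "'a set set \<Rightarrow> 'a state \<Rightarrow> bool" where
  "stable E s \<longleftrightarrow> (\<nexists>s'. fire E s s')"

definition can_be_cleaned :: "'a set \<Rightarrow> 'a set set \<Rightarrow> ('a \<Rightarrow> nat) \<Rightarrow> bool" where
  "can_be_cleaned V E f \<longleftrightarrow> (\<exists>g. (fire E)\<^sup>*\<^sup>* (f, V) (g, {}))"

text \<open>Configurations are total functions; their values outside \<open>V\<close> play no role.\<close>

definition brush_number :: "'a set \<Rightarrow> 'a set set \<Rightarrow> nat" where
  "brush_number V E = (LEAST n. \<exists>f. can_be_cleaned V E f \<and> n = (\<Sum>v\<in>V. f v))"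

text \<open>The choice operator fixes an arbitrary maximal firing sequence. By \<open>fire_confluent\<close> below,
  its result is unique except for the brushes left on clean vertices, which are never used again.\<close>

definition settle :: "'a set set \<Rightarrow> 'a state \<Rightarrow> 'a state" where
  "settle E s = (SOME s'. (fire E)\<^sup>*\<^sup>* s s' \<and> stable E s')"

fun place_brush :: "'a set set \<Rightarrow> 'a \<Rightarrow> 'a state \<Rightarrow> 'a state" where
  "place_brush E v (f, D) = settle E (f(v := f v + 1), D)"

lemma fires_invariant:
  assumes "(fire E)\<^sup>*\<^sup>* s s'" "finite (snd s)"
  shows "snd s' \<subseteq> snd s \<and>
    (\<forall>u\<in>snd s'. fst s' u = fst s u + card (dirty_nbrs E (snd s - snd s') u))"
  using assms
proof (induction rule: rtranclp_induct)
  case base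
  then show ?case by (simp add: dirty_nbrs_def)
next
  case (step y z)
  obtain f C v where y: "y = (f, C)" and v: "v \<in> C"
    and z: "z = (\<lambda>u. if u \<in> dirty_nbrs E C v then f u + 1 else f u, C - {v})"
    using step.hyps(2) by (auto elim!: fire.cases)
  have IH: "C \<subseteq> snd s" "\<And>u. u \<in> C \<Longrightarrow> f u = fst s u + card (dirty_nbrs E (snd s - C) u)"
    using step y by auto
  have "fst z u = fst s u + card (dirty_nbrs E (snd s - snd z) u)" if u: "u \<in> C - {v}" for u
  proof -
    have fin: "finite (dirty_nbrs E (snd s - C) u)"
      using step.prems by (simp add: dirty_nbrs_def)
    have "dirty_nbrs E (snd s - (C - {v})) u =
        (if {u, v} \<in> E then insert v (dirty_nbrs E (snd s - C) u) else dirty_nbrs E (snd s - C) u)"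
      using IH(1) v by (auto simp: dirty_nbrs_def insert_commute)
    moreover have "v \<notin> dirty_nbrs E (snd s - C) u"
      using v by (simp add: dirty_nbrs_def)
    moreover have "u \<in> dirty_nbrs E C v \<longleftrightarrow> {u, v} \<in> E"
      using u by (simp add: dirty_nbrs_def)
    ultimately show ?thesis
      using IH(2)[of u] u fin by (simp add: z)
  qed
  then show ?case
    using IH(1) by (auto simp: z)
qed

lemma stable_subset:
  assumes "(fire E)\<^sup>*\<^sup>* s s2" "(fire E)\<^sup>*\<^sup>* s s1" "stable E s1" "finite (snd s)"
  shows "snd s1 \<subseteq> snd s2"
  using assms
proof (induction rule: rtranclp_induct)
  case base
  then show ?case using fires_invariant by blast
next
  case (step y z)
  obtain f C v where y: "y = (f, C)" and v: "v \<in> C" "card (dirty_nbrs E C v) \<le> f v"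
    and z: "snd z = C - {v}"
    using step.hyps(2) by (auto elim!: fire.cases)
  obtain g B where s1: "s1 = (g, B)" by fastforce
  have BC: "B \<subseteq> C" using step y s1 by auto
  have "v \<notin> B"
  proof
    assume vB: "v \<in> B"
    have inv1: "B \<subseteq> snd s" "g v = fst s v + card (dirty_nbrs E (snd s - B) v)"
      using fires_invariant[OF step.prems(1,3)] s1 vB by auto
    have inv2: "C \<subseteq> snd s" "f v = fst s v + card (dirty_nbrs E (snd s - C) v)"
      using fires_invariant[OF step.hyps(1) step.prems(3)] y v by auto
    have "card (dirty_nbrs E B v) \<le> card (dirty_nbrs E C v)"
      using BC inv2(1) step.prems(3)
      by (intro card_mono) (auto simp: dirty_nbrs_def intro: finite_subset)
    moreover have "card (dirty_nbrs E (snd s - C) v) \<le> card (dirty_nbrs E (snd s - B) v)"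
      using BC step.prems(3) by (intro card_mono) (auto simp: dirty_nbrs_def)
    ultimately have "card (dirty_nbrs E B v) \<le> g v"
      using v inv1 inv2 by linarith
    then show False
      using vB step.prems(2) fire.intros[of v B E g] by (auto simp: stable_def s1)
  qed
  then show ?case using BC z s1 by auto
qed

lemma fire_confluent:
  assumes "(fire E)\<^sup>*\<^sup>* s s1" "stable E s1" "(fire E)\<^sup>*\<^sup>* s s2" "stable E s2" "finite (snd s)"
  shows "snd s1 = snd s2 \<and> (\<forall>u\<in>snd s1. fst s1 u = fst s2 u)"
proof -
  have "snd s1 = snd s2"
    using stable_subset[OF assms(1,3,4,5)] stable_subset[OF assms(3,1,2,5)] by simp
  then show ?thesis
    using fires_invariant[OF assms(1,5)] fires_invariant[OF assms(3,5)] by simp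
qed

lemma settle_exists:
  assumes "finite (snd s)"
  shows "\<exists>s'. (fire E)\<^sup>*\<^sup>* s s' \<and> stable E s'"
  using assms
proof (induction "card (snd s)" arbitrary: s rule: less_induct)
  case less
  show ?case
  proof (cases "stable E s")
    case True
    then show ?thesis by blast
  next
    case False
    then obtain t where t: "fire E s t" by (auto simp: stable_def)
    then have "card (snd t) < card (snd s)" "finite (snd t)"
      using less.prems by (auto elim!: fire.cases intro!: psubset_card_mono)
    then show ?thesis
      using less.hyps t by (meson converse_rtranclp_into_rtranclp)
  qed
qed

lemma settle:
  assumes "finite (snd s)"
  shows "(fire E)\<^sup>*\<^sup>* s (settle E s)" "stable E (settle E s)"
  using someI_ex[OF settle_exists[OF assms, of E]] by (auto simp: settle_def)

lemma place_brush_decreases: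
  assumes fin: "finite D" and v: "v \<in> D" and p: "place_brush E v (f, D) = (g, C)"
  shows "finite C"
    and "card C < card D \<or> card C = card D \<and> (\<Sum>u\<in>C. card D - g u) < (\<Sum>u\<in>D. card D - f u)"
proof -
  let ?f = "f(v := f v + 1)"
  have r: "(fire E)\<^sup>*\<^sup>* (?f, D) (g, C)" and st: "stable E (g, C)"
    using settle[of "(?f, D)" E] fin p by simp_all
  have inv: "C \<subseteq> D" "\<And>u. u \<in> C \<Longrightarrow> g u = ?f u + card (dirty_nbrs E (D - C) u)"
    using fires_invariant[OF r] fin by auto
  show "finite C" using inv(1) fin by (rule finite_subset)
  show "card C < card D \<or> card C = card D \<and> (\<Sum>u\<in>C. card D - g u) < (\<Sum>u\<in>D. card D - f u)"
  proof (cases "C = D")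
    case True
    then have g: "g u = ?f u" if "u \<in> D" for u
      using inv(2)[of u] that by (simp add: dirty_nbrs_def)
    have "g v < card (dirty_nbrs E D v)"
      using st v True fire.intros[of v D E g] by (force simp: stable_def not_le)
    also have "\<dots> \<le> card D"
      using fin by (intro card_mono) (auto simp: dirty_nbrs_def)
    finally have "card D - g v < card D - f v"
      using g[OF v] by simp
    moreover have "card D - g u \<le> card D - f u" if "u \<in> D" for u
      using g[OF that] by (simp add: diff_le_mono2)
    ultimately have "(\<Sum>u\<in>D. card D - g u) < (\<Sum>u\<in>D. card D - f u)"
      using fin v by (intro sum_strict_mono_ex1) auto
    then show ?thesis using True by simp
  next
    case False
    then show ?thesis using inv(1) fin by (simp add: psubset_card_mono psubsetI)
  qed
qed

datatype player = Minimizer | Maximizer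

fun opponent :: "player \<Rightarrow> player" where
  "opponent Minimizer = Maximizer"
| "opponent Maximizer = Minimizer"

fun best :: "player \<Rightarrow> nat set \<Rightarrow> nat" where
  "best Minimizer = Min"
| "best Maximizer = Max"

text \<open>The number of turns still to come under optimal play from a given state, where the player
  \<open>p\<close> moves next. An infinite set of dirty vertices gets a dummy value.\<close>

function game_length :: "'a set set \<Rightarrow> player \<Rightarrow> 'a state \<Rightarrow> nat" where
  "game_length E p (f, D) =
    (if finite D \<and> D \<noteq> {}
     then 1 + best p ((\<lambda>v. game_length E (opponent p) (place_brush E v (f, D))) ` D)
     else 0)"
  by pat_completeness auto
termination
proof (relation "inv_image (less_than <*lex*> less_than)
    (\<lambda>(E, p, f, D). (card D, \<Sum>u\<in>D. card D - f u))", goal_cases)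
  case 1
  show ?case by (intro wf_inv_image wf_lex_prod wf_less_than)
next
  case (2 E p f D v)
  obtain g C where p: "place_brush E v (f, D) = (g, C)" by fastforce
  show ?case
    using place_brush_decreases(2)[of D v E f g C] 2 p by auto
qed

declare game_length.simps [simp del]

definition game_brush_number :: "'a set \<Rightarrow> 'a set set \<Rightarrow> nat" where
  "game_brush_number V E = game_length E Minimizer (\<lambda>_. 0, V)"

definition game_brush_number_hat :: "'a set \<Rightarrow> 'a set set \<Rightarrow> nat" where
  "game_brush_number_hat V E = game_length E Maximizer (\<lambda>_. 0, V)"

text \<open>The upper bounds on the game brush numbers fail for a nonempty graph without edges: nothing
  needs to be placed to clean it, but the game ends only after the first turn.\<close>

lemma edgeless_brush_number: "brush_number V {} = 0" if "finite V"
proof -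
  have "\<exists>g. (fire {})\<^sup>*\<^sup>* (\<lambda>_. 0, V) (g, {})"
  proof -
    obtain g D where s: "settle {} (\<lambda>_. 0, V) = (g, D)" by fastforce
    then have "D = {}"
      using settle(2)[of "(\<lambda>_. 0, V)" "{}"] that fire.intros[of _ D "{}" g]
      by (fastforce simp: stable_def dirty_nbrs_def)
    then show ?thesis using settle(1)[of "(\<lambda>_. 0, V)" "{}"] that s by auto
  qed
  then show ?thesis
    unfolding brush_number_def can_be_cleaned_def
    by (intro Least_equality exI[of _ "\<lambda>_. 0"]) auto
qed

lemma edgeless_game_length: "game_length {} p (f, V) = 1" if "finite V" "V \<noteq> {}"
proof -
  have "game_length {} (opponent p) (place_brush {} v (f, V)) = 0" for v
  proof -
    obtain g D where s: "place_brush {} v (f, V) = (g, D)" by fastforce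
    then have "D = {}"
      using settle(2)[of "(f(v := f v + 1), V)" "{}"] that fire.intros[of _ D "{}" g]
      by (fastforce simp: stable_def dirty_nbrs_def)
    then show ?thesis using s by (simp add: game_length.simps)
  qed
  then show ?thesis
    using that by (cases p) (simp_all add: game_length.simps[of _ _ f V] image_constant_conv)
qed

end

theory Submission imports Defs begin

text \<open>Firing is monotone: a brush added to a vertex that is still dirty can be added at the very
  start without invalidating any earlier firing (\<open>fires_add_brush\<close>). A position of the game is
  therefore always reachable by firing alone from the configuration \<open>p\<close> of all brushes that the
  players have placed so far. This gives the lower bounds at once, however the game is played: when
  everything is clean, \<open>p\<close> cleans the graph, so the game has lasted at least \<open>b(G)\<close> turns.

  For the upper bounds, Min fixes a cleaning configuration \<open>f\<close> with \<open>b(G)\<close> brushes and always plays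
  on a dirty vertex \<open>v\<close> with \<open>p v < f v\<close>. The deficit, that is, the sum of \<open>f v - p v\<close> over the dirty
  vertices (with truncated subtraction), starts at \<open>b(G)\<close>, drops with every move of Min, and never
  grows. Such a \<open>v\<close> exists as long as the graph is not clean: if \<open>p\<close> dominated \<open>f\<close> on a nonempty set
  of dirty vertices, then the first of these to be fired by the cleaning sequence of \<open>f\<close> could fire
  in the position as well (\<open>dominating_position_clean\<close>). So Min moves at most \<open>b(G)\<close> times, and the
  game ends with one of these moves, or earlier; this is \<open>2 b(G) - 1\<close> turns if Min starts, and one
  more if Max starts. The one point where edges matter is the opening: it is the only position
  whose possible firings have not been carried out, and there the deficit is positive because
  a graph with an edge has a positive brush number.\<close>

section \<open>Cleaning configurations and the brush number\<close>

lemma brush_number_le: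
  "brush_number V E \<le> (\<Sum>v\<in>V. f v)" if "can_be_cleaned V E f"
  unfolding brush_number_def using that by (intro Least_le) blast

lemma ex_can_be_cleaned:
  assumes "finite V"
  shows "\<exists>f. can_be_cleaned V E f"
proof -
  \<comment> \<open>With \<open>card V\<close> brushes everywhere, no dirty vertex is ever blocked.\<close>
  obtain g D where s: "settle E (\<lambda>_. card V, V) = (g, D)" by fastforce
  have r: "(fire E)\<^sup>*\<^sup>* (\<lambda>_. card V, V) (g, D)" and st: "stable E (g, D)"
    using settle[of "(\<lambda>_. card V, V)" E] assms s by simp_all
  have "v \<notin> D" for v
  proof
    assume v: "v \<in> D"
    have DV: "D \<subseteq> V" and "card V \<le> g v"
      using fires_invariant[OF r] assms v by auto
    moreover have "card (dirty_nbrs E D v) \<le> card V"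
      using DV assms by (intro card_mono) (auto simp: dirty_nbrs_def)
    ultimately have "card (dirty_nbrs E D v) \<le> g v" by simp
    then show False
      using st v fire.intros[of v D E g] by (auto simp: stable_def)
  qed
  then have "D = {}" by blast
  then show ?thesis using r by (auto simp: can_be_cleaned_def)
qed

lemma brush_number_attained:
  assumes "finite V"
  obtains f where "can_be_cleaned V E f" "(\<Sum>v\<in>V. f v) = brush_number V E"
proof -
  have "\<exists>n f. can_be_cleaned V E f \<and> n = (\<Sum>v\<in>V. f v)"
    using ex_can_be_cleaned[OF assms] by blast
  then have "\<exists>f. can_be_cleaned V E f \<and> brush_number V E = (\<Sum>v\<in>V. f v)"
    unfolding brush_number_def by (rule LeastI_ex)
  then show thesis using that by metis
qed

text \<open>Without brushes only isolated vertices ever fire: firing them moves no brush, so a vertex on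
  an edge keeps zero brushes and its dirty neighbor.\<close>

lemma cleaning_needs_brush:
  assumes G: "simple_graph V E" and "E \<noteq> {}" and clean: "can_be_cleaned V E f"
  shows "0 < (\<Sum>v\<in>V. f v)"
proof (rule ccontr)
  have fin: "finite V" using G by (simp add: simple_graph_def)
  assume "\<not> 0 < (\<Sum>v\<in>V. f v)"
  then have f0: "f v = 0" if "v \<in> V" for v using that fin by simp
  have edges_dirty: "\<Union>E \<subseteq> snd s" if "(fire E)\<^sup>*\<^sup>* (f, V) s" for s
    using that
  proof (induction rule: rtranclp_induct)
    case base
    then show ?case using G by (auto simp: simple_graph_def)
  next
    case (step y z)
    obtain h C v where y: "y = (h, C)" and v: "v \<in> C" "card (dirty_nbrs E C v) \<le> h v"
      and z: "snd z = C - {v}"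
      using step.hyps(2) by (auto elim!: fire.cases)
    have inv: "C \<subseteq> V" "h v = f v + card (dirty_nbrs E (V - C) v)"
      using fires_invariant[OF step.hyps(1)] fin y v by auto
    have "dirty_nbrs E (V - C) v = {}"
      using step.IH y by (auto simp: dirty_nbrs_def)
    then have "card (dirty_nbrs E C v) = 0"
      using inv v f0[of v] by auto
    moreover have "finite (dirty_nbrs E C v)"
      using inv(1) fin by (auto simp: dirty_nbrs_def intro: finite_subset)
    ultimately have no_nbrs: "dirty_nbrs E C v = {}" by simp
    have "v \<notin> \<Union>E"
    proof
      assume "v \<in> \<Union>E"
      then obtain e where e: "e \<in> E" "v \<in> e" by blast
      then have "card e = 2" using G by (simp add: simple_graph_def)
      then obtain u where "e = {u, v}"
        using e(2) by (auto simp: card_2_iff)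
      then have "u \<in> dirty_nbrs E C v"
        using e(1) step.IH y by (auto simp: dirty_nbrs_def)
      then show False using no_nbrs by simp
    qed
    then show ?case using step.IH y z by auto
  qed
  obtain g where "(fire E)\<^sup>*\<^sup>* (f, V) (g, {})"
    using clean by (auto simp: can_be_cleaned_def)
  from edges_dirty[OF this] have "\<Union>E = {}" by simp
  then have "e = {}" if "e \<in> E" for e using that by blast
  then show False using \<open>E \<noteq> {}\<close> G by (force simp: simple_graph_def)
qed

section \<open>Positions of the game as results of firing\<close>

lemma fires_add_brush:
  assumes "(fire E)\<^sup>*\<^sup>* (p, V) s" and "v \<in> snd s"
  shows "(fire E)\<^sup>*\<^sup>* (p(v := p v + 1), V) ((fst s)(v := fst s v + 1), snd s)"
  using assms
proof (induction rule: rtranclp_induct)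
  case base
  then show ?case by simp
next
  case (step y z)
  obtain h C w where y: "y = (h, C)" and w: "w \<in> C" "card (dirty_nbrs E C w) \<le> h w"
    and z: "z = (\<lambda>u. if u \<in> dirty_nbrs E C w then h u + 1 else h u, C - {w})"
    using step.hyps(2) by (auto elim!: fire.cases)
  let ?h = "h(v := h v + 1)"
  have "fire E (?h, C) (\<lambda>u. if u \<in> dirty_nbrs E C w then ?h u + 1 else ?h u, C - {w})"
    using w by (intro fire.intros) auto
  moreover have "(\<lambda>u. if u \<in> dirty_nbrs E C w then ?h u + 1 else ?h u)
      = (fst z)(v := fst z v + 1)"
    by (auto simp: z)
  ultimately have "fire E (?h, C) ((fst z)(v := fst z v + 1), snd z)"
    by (simp only: z snd_conv)
  moreover have "(fire E)\<^sup>*\<^sup>* (p(v := p v + 1), V) (?h, C)"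
    using step.IH step.prems y z by (simp add: fun_upd_def)
  ultimately show ?case by (rule rtranclp.rtrancl_into_rtrancl[rotated])
qed

lemma place_brush_reached:
  assumes fin: "finite V" and r: "(fire E)\<^sup>*\<^sup>* (p, V) (g, D)" and v: "v \<in> D"
    and s: "place_brush E v (g, D) = (h, C)"
  shows "(fire E)\<^sup>*\<^sup>* (p(v := p v + 1), V) (h, C)" and "stable E (h, C)" and "C \<subseteq> D"
proof -
  have "finite D"
    using fires_invariant[OF r] fin by (auto intro: finite_subset)
  then have t: "(fire E)\<^sup>*\<^sup>* (g(v := g v + 1), D) (h, C)" and st: "stable E (h, C)"
    using settle[of "(g(v := g v + 1), D)" E] s by simp_all
  show "(fire E)\<^sup>*\<^sup>* (p(v := p v + 1), V) (h, C)"
    using rtranclp_trans[OF fires_add_brush[OF r, of v]] v t by simp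
  show "stable E (h, C)" by (rule st)
  show "C \<subseteq> D" using fires_invariant[OF t] \<open>finite D\<close> by simp
qed

section \<open>The lower bound\<close>

lemma best_in: "finite A \<Longrightarrow> A \<noteq> {} \<Longrightarrow> best q A \<in> A"
  by (cases q) simp_all

text \<open>No strategy enters: the bound holds for every sequence of moves, so it does not matter whose
  turn it is, and the optimal value is attained by one of the moves.\<close>

lemma brush_number_le_game_length:
  assumes fin: "finite V" and "(fire E)\<^sup>*\<^sup>* (p, V) (g, D)"
  shows "brush_number V E \<le> game_length E q (g, D) + (\<Sum>v\<in>V. p v)"
  using assms(2)
proof (induction E q "(g, D)" arbitrary: p g D rule: game_length.induct)
  case (1 E q g D)
  have DV: "D \<subseteq> V"
    using fires_invariant[OF "1.prems"] fin by auto
  show ?case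
  proof (cases "D = {}")
    case True
    then have "can_be_cleaned V E p"
      using "1.prems" by (auto simp: can_be_cleaned_def)
    then show ?thesis by (intro trans_le_add2 brush_number_le)
  next
    case False
    have finD: "finite D" using DV fin by (rule finite_subset)
    let ?L = "\<lambda>v. game_length E (opponent q) (place_brush E v (g, D))"
    have "best q (?L ` D) \<in> ?L ` D"
      using False finD by (intro best_in) auto
    then obtain v where v: "v \<in> D" and L: "game_length E q (g, D) = 1 + ?L v"
      using False finD by (auto simp: game_length.simps[of _ _ g D])
    obtain h C where s: "place_brush E v (g, D) = (h, C)" by fastforce
    have "brush_number V E \<le> ?L v + (\<Sum>u\<in>V. (p(v := p v + 1)) u)"
      using "1.hyps"[of v h C "p(v := p v + 1)"] False finD v s
        place_brush_reached(1)[OF fin "1.prems" v s] by simp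
    also have "(\<Sum>u\<in>V. (p(v := p v + 1)) u) = (\<Sum>u\<in>V. p u) + 1"
      using v DV fin by (subst (1 2) sum.remove[of _ v]) (auto intro!: sum.cong)
    finally show ?thesis using L by simp
  qed
qed

section \<open>The strategy of Min\<close>

text \<open>The first vertex of \<open>D\<close> that the cleaning sequence of \<open>f\<close> fires has seen at that time only
  neighbors outside \<open>D\<close> fire. In the position all of these are clean too, so it has received at
  least as many brushes from its neighbors, has at least as many placed on it, and has at most as
  many dirty neighbors left: it could still fire.\<close>

lemma dominating_position_clean:
  assumes fin: "finite V" and clean: "can_be_cleaned V E f"
    and r: "(fire E)\<^sup>*\<^sup>* (p, V) (g, D)" and st: "stable E (g, D)"
    and dom: "\<And>v. v \<in> D \<Longrightarrow> f v \<le> p v"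
  shows "D = {}"
proof -
  have inv: "D \<subseteq> V" "\<And>v. v \<in> D \<Longrightarrow> g v = p v + card (dirty_nbrs E (V - D) v)"
    using fires_invariant[OF r] fin by auto
  have "D \<subseteq> snd s" if "(fire E)\<^sup>*\<^sup>* (f, V) s" for s
    using that
  proof (induction rule: rtranclp_induct)
    case base
    then show ?case using inv by simp
  next
    case (step y z)
    obtain h C v where y: "y = (h, C)" and v: "v \<in> C" "card (dirty_nbrs E C v) \<le> h v"
      and z: "snd z = C - {v}"
      using step.hyps(2) by (auto elim!: fire.cases)
    have DC: "D \<subseteq> C" using step.IH y by simp
    have "v \<notin> D"
    proof
      assume vD: "v \<in> D"
      have invC: "C \<subseteq> V" "h v = f v + card (dirty_nbrs E (V - C) v)"
        using fires_invariant[OF step.hyps(1)] fin y v by auto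
      have "card (dirty_nbrs E D v) \<le> card (dirty_nbrs E C v)"
        using DC invC(1) fin
        by (intro card_mono) (auto simp: dirty_nbrs_def intro: finite_subset)
      moreover have "card (dirty_nbrs E (V - C) v) \<le> card (dirty_nbrs E (V - D) v)"
        using DC fin by (intro card_mono) (auto simp: dirty_nbrs_def)
      ultimately have "card (dirty_nbrs E D v) \<le> g v"
        using v invC inv(2)[OF vD] dom[OF vD] by linarith
      then show False
        using vD st fire.intros[of v D E g] by (auto simp: stable_def)
    qed
    then show ?case using DC z by auto
  qed
  then show ?thesis
    using clean by (fastforce simp: can_be_cleaned_def)
qed

text \<open>The number of brushes of \<open>f\<close> that are still to be placed when those of \<open>p\<close> lie on the graph;
  surplus brushes on one vertex do not make up for missing ones on another.\<close>

definition deficit :: "('a \<Rightarrow> nat) \<Rightarrow> ('a \<Rightarrow> nat) \<Rightarrow> 'a set \<Rightarrow> nat" where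
  "deficit f p D = (\<Sum>v\<in>D. f v - p v)"

lemma deficit_pos:
  assumes "finite V" "can_be_cleaned V E f"
    and r: "(fire E)\<^sup>*\<^sup>* (p, V) (g, D)" and "stable E (g, D)" "D \<noteq> {}"
  shows "0 < deficit f p D"
proof (rule ccontr)
  have "finite D"
    using fires_invariant[OF r] \<open>finite V\<close> by (auto intro: finite_subset)
  moreover assume "\<not> 0 < deficit f p D"
  ultimately have "\<And>v. v \<in> D \<Longrightarrow> f v \<le> p v"
    by (auto simp: deficit_def)
  then show False using dominating_position_clean assms by blast
qed

lemma deficit_place_le:
  "finite D \<Longrightarrow> C \<subseteq> D \<Longrightarrow> deficit f (p(v := p v + 1)) C \<le> deficit f p D"
  unfolding deficit_def
  by (rule order_trans[OF sum_mono2[of D C] sum_mono]) auto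

lemma deficit_place_less:
  assumes "finite D" "C \<subseteq> D" "v \<in> D" "p v < f v"
  shows "deficit f (p(v := p v + 1)) C < deficit f p D"
proof -
  have "deficit f (p(v := p v + 1)) C \<le> (\<Sum>u\<in>D. f u - (p(v := p v + 1)) u)"
    unfolding deficit_def using assms by (intro sum_mono2) auto
  also have "\<dots> < deficit f p D"
    unfolding deficit_def using assms
    by (intro sum_strict_mono_ex1 bexI[of _ v]) auto
  finally show ?thesis .
qed

lemma game_length_clean: "game_length E q (g, {}) = 0"
  by (simp add: game_length.simps)

lemma game_length_Minimizer_le:
  assumes "finite D" "v \<in> D"
  shows "game_length E Minimizer (g, D) \<le> 1 + game_length E Maximizer (place_brush E v (g, D))"
  using assms by (auto simp: game_length.simps[of _ _ g D] intro!: Min_le)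

lemma game_length_Maximizer_le:
  assumes "finite D"
    and "\<And>v. v \<in> D \<Longrightarrow> game_length E Minimizer (place_brush E v (g, D)) \<le> n"
  shows "game_length E Maximizer (g, D) \<le> 1 + n"
  using assms by (auto simp: game_length.simps[of _ _ g D])

text \<open>A move of Max cannot raise the deficit, and it leaves a stable position, in which Min can play
  on a deficient vertex. The bound on Min's positions is a hypothesis because it serves at two
  places: as the induction hypothesis for Min's strategy, and as its result when Max opens.\<close>

lemma game_length_Maximizer_deficit:
  assumes fin: "finite V" and clean: "can_be_cleaned V E f"
    and r: "(fire E)\<^sup>*\<^sup>* (p, V) (g, D)" and d: "deficit f p D \<le> k"
    and Minimizer: "\<And>p g D. (fire E)\<^sup>*\<^sup>* (p, V) (g, D) \<Longrightarrow> deficit f p D \<le> k \<Longrightarrow>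
      (D \<noteq> {} \<Longrightarrow> 0 < deficit f p D) \<Longrightarrow> game_length E Minimizer (g, D) \<le> n"
  shows "game_length E Maximizer (g, D) \<le> 1 + n"
proof (rule game_length_Maximizer_le)
  show finD: "finite D"
    using fires_invariant[OF r] fin by (auto intro: finite_subset)
  fix v assume v: "v \<in> D"
  let ?p = "p(v := p v + 1)"
  obtain h C where s: "place_brush E v (g, D) = (h, C)" by fastforce
  note r' = place_brush_reached[OF fin r v s]
  have "deficit f ?p C \<le> k"
    using deficit_place_le[OF finD r'(3), of f p v] d by linarith
  then show "game_length E Minimizer (place_brush E v (g, D)) \<le> n"
    using Minimizer[OF r'(1)] deficit_pos[OF fin clean r'(1,2)] s by simp
qed

text \<open>The last hypothesis provides Min with a vertex to play on. It asks for a positive deficit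
  rather than for stability so that it covers the opening position, where isolated vertices are
  ready to fire.\<close>

lemma game_length_Minimizer_deficit:
  assumes fin: "finite V" and clean: "can_be_cleaned V E f"
    and "(fire E)\<^sup>*\<^sup>* (p, V) (g, D)"
    and "deficit f p D \<le> k" and "D \<noteq> {} \<Longrightarrow> 0 < deficit f p D"
  shows "game_length E Minimizer (g, D) \<le> 2 * k - 1"
  using assms(3-)
proof (induction k arbitrary: p g D)
  case 0
  then show ?case by (cases "D = {}") (auto simp: game_length_clean)
next
  case (Suc k)
  show ?case
  proof (cases "D = {}")
    case True
    then show ?thesis by (simp add: game_length_clean)
  next
    case False
    have finD: "finite D"
      using fires_invariant[OF Suc.prems(1)] fin by (auto intro: finite_subset)
    have "deficit f p D = 0" if "\<forall>v\<in>D. f v \<le> p v"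
      using that by (simp add: deficit_def)
    then have "\<not> (\<forall>v\<in>D. f v \<le> p v)"
      using Suc.prems(3)[OF False] by fastforce
    then obtain v where v: "v \<in> D" "p v < f v" by (auto simp: not_le)
    let ?p = "p(v := p v + 1)"
    obtain h C where s: "place_brush E v (g, D) = (h, C)" by fastforce
    note r = place_brush_reached[OF fin Suc.prems(1) v(1) s]
    have dC: "deficit f ?p C \<le> k"
      using deficit_place_less[of D C v p f] finD r(3) v Suc.prems(2) by simp
    have "game_length E Maximizer (h, C) \<le> 2 * k"
    proof (cases "C = {}")
      case True
      then show ?thesis by (simp add: game_length_clean)
    next
      case False
      have "0 < k"
        using deficit_pos[OF fin clean r(1,2) False] dC by simp
      moreover have "game_length E Maximizer (h, C) \<le> 1 + (2 * k - 1)"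
        using game_length_Maximizer_deficit[OF fin clean r(1) dC] Suc.IH by blast
      ultimately show ?thesis by simp
    qed
    then show ?thesis
      using game_length_Minimizer_le[OF finD v(1), of E g] s by simp
  qed
qed

theorem proposition2:
  fixes V :: "'a set" and E :: "'a set set"
  assumes "simple_graph V E"
  shows "(brush_number V E \<le> game_brush_number V E \<and>
          (E \<noteq> {} \<longrightarrow> int (game_brush_number V E) \<le> 2 * int (brush_number V E) - 1)) \<and>
         (brush_number V E \<le> game_brush_number_hat V E \<and>
          (E \<noteq> {} \<longrightarrow> game_brush_number_hat V E \<le> 2 * brush_number V E))"
proof -
  have fin: "finite V" using assms by (simp add: simple_graph_def)
  have lower: "brush_number V E \<le> game_length E q (\<lambda>_. 0, V)" for q
    using brush_number_le_game_length[OF fin, of E "\<lambda>_. 0"] by simp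
  have upper: "game_length E Minimizer (\<lambda>_. 0, V) \<le> 2 * brush_number V E - 1"
    "game_length E Maximizer (\<lambda>_. 0, V) \<le> 2 * brush_number V E"
    "0 < brush_number V E" if "E \<noteq> {}"
  proof -
    obtain f where f: "can_be_cleaned V E f" "(\<Sum>v\<in>V. f v) = brush_number V E"
      using brush_number_attained[OF fin] .
    show pos: "0 < brush_number V E"
      using cleaning_needs_brush[OF assms that f(1)] f(2) by simp
    have d: "deficit f (\<lambda>_. 0) V = brush_number V E"
      using f(2) by (simp add: deficit_def)
    show "game_length E Minimizer (\<lambda>_. 0, V) \<le> 2 * brush_number V E - 1"
      using game_length_Minimizer_deficit[OF fin f(1), of "\<lambda>_. 0"] d pos by simp
    have "game_length E Maximizer (\<lambda>_. 0, V) \<le> 1 + (2 * brush_number V E - 1)"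
      using game_length_Maximizer_deficit[OF fin f(1) rtranclp.rtrancl_refl eq_refl[OF d]]
        game_length_Minimizer_deficit[OF fin f(1)] by blast
    then show "game_length E Maximizer (\<lambda>_. 0, V) \<le> 2 * brush_number V E"
      using pos by simp
  qed
  show ?thesis
    using lower upper unfolding game_brush_number_def game_brush_number_hat_def by fastforce
qed

end
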